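(* A removal process on a finite set $E$ is a pruning process if and only if, for each subset $S$ of $E$, there is a unique minimal (with respect to inclusion) set $\tau(S)$ containing $S$ among the sets achievable by the removal process.
   Context: A removal process on a finite set $E$ is a procedure in which, starting from $E$, elements are removed one at a time according to a given rule. It is described by its collection $\mathcal{N} \subseteq 2^E$ of achievable sets (the sets of remaining elements that can occur). Thus $E \in \mathcal{N}$, and every $A \in \mathcal{N}$ is obtained through some chain $E = S_0 \supset S_1 \supset \cdots \supset S_k = A$ of members of $\mathcal{N}$ with $|S_i \setminus S_{i+1}| = 1$ for each $i$. An element $x \in A$ is removable from an achievable set $A$ if and only if $A \setminus \{x\} \in \mathcal{N}$. Every collection $\mathcal{N}$ with these two properties defines a removal process. A removal process is a pruning process if every element which is removable at some stage of the process remains removable at any later stage (until it is removed). That is, whenever $A \in \mathcal{N}$, $x \in A$ is removable from $A$, and $B \in \mathcal{N}$ is reached from $A$ by a sequence of successive removals of removable elements with $x \in B$, then $x$ is removable from $B$. *)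

theory Defs
  imports Main
begin

text \<open>A removal process on a finite ground set is given by its collection of achievable sets,
  i.e. the sets of remaining elements that can occur.\<close>

definition removal_process :: "'a set \<Rightarrow> 'a set set \<Rightarrow> bool" where
  "removal_process E N \<longleftrightarrow>
     finite E \<and> N \<subseteq> Pow E \<and> E \<in> N \<and>
     (\<forall>A\<in>N. \<exists>(k::nat) S. S 0 = E \<and> S k = A \<and> (\<forall>i\<le>k. S i \<in> N) \<and>
        (\<forall>i<k. S (Suc i) \<subset> S i \<and> card (S i - S (Suc i)) = 1))"

definition removable :: "'a set set \<Rightarrow> 'a set \<Rightarrow> 'a \<Rightarrow> bool" where
  "removable N A x \<longleftrightarrow> A \<in> N \<and> x \<in> A \<and> A - {x} \<in> N"

definition removal_step :: "'a set set \<Rightarrow> 'a set \<Rightarrow> 'a set \<Rightarrow> bool" where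
  "removal_step N A B \<longleftrightarrow> (\<exists>x. removable N A x \<and> B = A - {x})"

text \<open>The later stages of the process after \<open>A\<close> are the sets \<open>B\<close> reached from \<open>A\<close> by finitely many
  (possibly zero) removal steps, which is in general stronger than \<open>B \<in> N\<close> and \<open>B \<subseteq> A\<close>.\<close>

definition pruning_process :: "'a set \<Rightarrow> 'a set set \<Rightarrow> bool" where
  "pruning_process E N \<longleftrightarrow>
     removal_process E N \<and>
     (\<forall>A\<in>N. \<forall>x\<in>A. \<forall>B\<in>N.
        removable N A x \<longrightarrow> (removal_step N)\<^sup>*\<^sup>* A B \<longrightarrow> x \<in> B \<longrightarrow> removable N B x)"

definition minimal_achievable_containing :: "'a set set \<Rightarrow> 'a set \<Rightarrow> 'a set \<Rightarrow> bool" where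
  "minimal_achievable_containing N S T \<longleftrightarrow>
     T \<in> N \<and> S \<subseteq> T \<and> \<not> (\<exists>T'\<in>N. S \<subseteq> T' \<and> T' \<subset> T)"

end

theory Submission
  imports Defs
begin

text \<open>Removal steps of a pruning process commute: if \<open>A\<close> is reached from \<open>X\<close> and \<open>x\<close> is removable
  from \<open>X\<close>, then either \<open>x \<notin> A\<close> and \<open>X - {x}\<close> still leads to \<open>A\<close>, or \<open>x\<close> is removable from \<open>A\<close>.
  For a minimal achievable \<open>A \<supseteq> S\<close>, the second alternative cannot occur along a removal sequence
  from \<open>E\<close> to an achievable \<open>B \<supseteq> S\<close>, hence \<open>A \<subseteq> B\<close>. Conversely, if \<open>x\<close> is removable from \<open>A\<close>
  and \<open>x \<in> B \<subseteq> A\<close>, then \<open>\<tau>(B - {x})\<close> lies below both \<open>B\<close> and \<open>A - {x}\<close>, so it equals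
  \<open>B - {x}\<close>.\<close>

text \<open>The chain condition enters the proof only here; the closure form permits rule induction
  from either end of a removal sequence.\<close>

lemma removal_process_reachable:
  assumes "removal_process E N" "A \<in> N"
  shows "(removal_step N)\<^sup>*\<^sup>* E A"
proof -
  obtain k :: nat and S where S: "S 0 = E" "S k = A" "\<forall>i\<le>k. S i \<in> N"
    "\<forall>i<k. S (Suc i) \<subset> S i \<and> card (S i - S (Suc i)) = 1"
    using assms unfolding removal_process_def by metis
  have "(removal_step N)\<^sup>*\<^sup>* E (S i)" if "i \<le> k" for i
    using that
  proof (induction i)
    case 0
    then show ?case using S(1) by simp
  next
    case (Suc i)
    have sub: "S (Suc i) \<subset> S i" and "card (S i - S (Suc i)) = 1"
      using S(4) Suc.prems by auto
    then obtain x where "S i - S (Suc i) = {x}" by (meson card_1_singletonE)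
    with sub have "x \<in> S i" "S (Suc i) = S i - {x}" by auto
    moreover have "S i \<in> N" "S (Suc i) \<in> N" using S(3) Suc.prems by auto
    ultimately have "removal_step N (S i) (S (Suc i))"
      unfolding removal_step_def removable_def by metis
    with Suc show ?case by (simp add: rtranclp.rtrancl_into_rtrancl)
  qed
  with S(2) show ?thesis by blast
qed

lemma removal_steps_subset: "(removal_step N)\<^sup>*\<^sup>* A B \<Longrightarrow> B \<subseteq> A"
  by (induction rule: rtranclp_induct) (auto simp: removal_step_def)

lemma removal_steps_achievable: "(removal_step N)\<^sup>*\<^sup>* A B \<Longrightarrow> A \<in> N \<Longrightarrow> B \<in> N"
  by (induction rule: rtranclp_induct) (auto simp: removal_step_def removable_def)

lemma pruning_processD:
  assumes "pruning_process E N" "removable N A x" "(removal_step N)\<^sup>*\<^sup>* A B" "x \<in> B"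
  shows "removable N B x"
proof -
  have "A \<in> N" "x \<in> A" using assms(2) by (auto simp: removable_def)
  with assms show ?thesis
    using removal_steps_achievable unfolding pruning_process_def by blast
qed

text \<open>Induction from the front of the sequence: \<open>x\<close> stays removable while other
  elements go, and since \<open>x \<notin> A\<close> some step removes \<open>x\<close>; up to
  there, \<open>x\<close> can be removed first.\<close>

lemma pruning_steps_commute:
  assumes "pruning_process E N" "(removal_step N)\<^sup>*\<^sup>* X A" "removable N X x" "x \<notin> A"
  shows "(removal_step N)\<^sup>*\<^sup>* (X - {x}) A"
  using assms(2,3)
proof (induction rule: converse_rtranclp_induct)
  case base
  with assms(4) show ?case by (auto simp: removable_def)
next
  case (step X Y)
  obtain y where y: "removable N X y" "Y = X - {y}"
    using step.hyps(1) by (auto simp: removal_step_def)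
  show ?case
  proof (cases "y = x")
    case True
    with step.hyps(2) y show ?thesis by simp
  next
    case False
    have x: "removable N Y x"
      using pruning_processD[OF assms(1) step.prems
          r_into_rtranclp[of "removal_step N", OF step.hyps(1)]]
        step.prems y False by (auto simp: removable_def)
    have "Y - {x} = X - {x} - {y}" using y(2) by blast
    \<comment> \<open>The other two sides of the square: \<open>y\<close> can go after
      \<open>x\<close> because \<open>Y - {x}\<close> is achievable.\<close>
    with x have "removal_step N (X - {x}) (Y - {x})"
      using step.prems y(1) False
      by (auto simp: removal_step_def removable_def intro!: exI[of _ y])
    with step.IH[OF x] show ?thesis
      by (simp add: converse_rtranclp_into_rtranclp)
  qed
qed

text \<open>The start \<open>X\<close> is arbitrary so that the induction can advance it along the
  path to \<open>B\<close> while \<open>A\<close> stays reachable from it.\<close>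

lemma pruning_minimal_subset:
  assumes "pruning_process E N" "minimal_achievable_containing N S A"
    and "(removal_step N)\<^sup>*\<^sup>* X B" "(removal_step N)\<^sup>*\<^sup>* X A" "S \<subseteq> B"
  shows "A \<subseteq> B"
  using assms(3,4)
proof (induction rule: converse_rtranclp_induct)
  case base
  from base.prems show ?case by (rule removal_steps_subset)
next
  case (step X Y)
  obtain x where x: "removable N X x" "Y = X - {x}"
    using step.hyps(1) by (auto simp: removal_step_def)
  have "x \<notin> A"
  proof
    assume "x \<in> A"
    with pruning_processD[OF assms(1) x(1) step.prems] have "A - {x} \<in> N"
      by (simp add: removable_def)
    \<comment> \<open>\<open>x \<notin> S\<close>, since
      \<open>S \<subseteq> B \<subseteq> Y = X - {x}\<close>.\<close>
    moreover have "S \<subseteq> A - {x}"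
      using assms(2,5) removal_steps_subset[OF step.hyps(2)] x(2)
      by (auto simp: minimal_achievable_containing_def)
    moreover have "A - {x} \<subset> A" using \<open>x \<in> A\<close> by blast
    ultimately show False
      using assms(2) unfolding minimal_achievable_containing_def by blast
  qed
  with pruning_steps_commute[OF assms(1) step.prems x(1)] x(2) step.IH show ?case
    by simp
qed

text \<open>Minimality among the sets below \<open>B\<close> is minimality in \<open>N\<close>, as
  anything smaller also lies below \<open>B\<close>.\<close>

lemma minimal_achievable_below:
  assumes "finite B" "B \<in> N" "S \<subseteq> B"
  obtains T where "minimal_achievable_containing N S T" "T \<subseteq> B"
proof -
  let ?F = "{T \<in> N. S \<subseteq> T \<and> T \<subseteq> B}"
  have "finite ?F" "B \<in> ?F"
    using assms by (auto intro: finite_subset[of _ "Pow B"])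
  then obtain T where "T \<in> ?F" "\<forall>T'\<in>?F. T' \<subseteq> T \<longrightarrow> T' = T"
    by (metis (no_types, lifting) finite_has_minimal2)
  then have "minimal_achievable_containing N S T" "T \<subseteq> B"
    unfolding minimal_achievable_containing_def by blast+
  with that show ?thesis by blast
qed

theorem corollary3p2:
  fixes E :: "'a set" and N :: "'a set set"
  assumes "removal_process E N"
  shows "pruning_process E N \<longleftrightarrow>
           (\<forall>S. S \<subseteq> E \<longrightarrow> (\<exists>!T. minimal_achievable_containing N S T))"
proof (intro iffI allI impI)
  fix S assume prune: "pruning_process E N" and "S \<subseteq> E"
  moreover have "finite E" "E \<in> N" using assms by (simp_all add: removal_process_def)
  ultimately obtain T where T: "minimal_achievable_containing N S T"
    by (metis minimal_achievable_below)
  have below: "A \<subseteq> B" if "minimal_achievable_containing N S A"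
    "minimal_achievable_containing N S B" for A B
    using pruning_minimal_subset[OF prune that(1), of E B] that
      removal_process_reachable[OF assms]
    by (simp add: minimal_achievable_containing_def)
  with T show "\<exists>!T. minimal_achievable_containing N S T"
    by (intro ex1I[of _ T]) (auto intro: equalityI)
next
  assume uniq: "\<forall>S. S \<subseteq> E \<longrightarrow> (\<exists>!T. minimal_achievable_containing N S T)"
  have fin: "finite A" "A \<subseteq> E" if "A \<in> N" for A
    using assms that by (auto simp: removal_process_def intro: finite_subset)
  have "removable N B x"
    if h: "B \<in> N" "removable N A x" "(removal_step N)\<^sup>*\<^sup>* A B" "x \<in> B" for A B x
  proof -
    have A: "A - {x} \<in> N" and sub: "B - {x} \<subseteq> A - {x}"
      using h(2) removal_steps_subset[OF h(3)] by (auto simp: removable_def)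
    obtain T where T: "minimal_achievable_containing N (B - {x}) T" "T \<subseteq> B"
      using minimal_achievable_below[OF fin(1)[OF h(1)] h(1) Diff_subset] .
    obtain T' where T': "minimal_achievable_containing N (B - {x}) T'" "T' \<subseteq> A - {x}"
      using minimal_achievable_below[OF fin(1)[OF A] A sub] .
    have "B - {x} \<subseteq> E" using fin(2) h(1) by blast
    with uniq T(1) T'(1) have "T = T'" by blast
    \<comment> \<open>\<open>T \<subseteq> B\<close> and, through \<open>T'\<close>,
      \<open>x \<notin> T\<close>; the reverse inclusion is part of minimality.\<close>
    with T T' have "T = B - {x}" "T \<in> N"
      by (auto simp: minimal_achievable_containing_def)
    with h(1,4) show ?thesis by (simp add: removable_def)
  qed
  with assms show "pruning_process E N"
    unfolding pruning_process_def by blast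
qed

end
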